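(* Let $\nu>0$. (1) Both $\mathcal{B}_H(\nu)$ and $\mathcal{B}^*_H(\nu)$ are affine invariant. (2) Each of $\mathcal{B}(\nu)$, $\mathcal{B}_H(\nu)$ and $\mathcal{B}^*_H(\nu)$ is linear invariant.
   Context: $\mathbb{D}$ is the open unit disk in $\mathbb{C}$. A harmonic mapping in $\mathbb{D}$ is a complex-valued $f$ with $f_{z\overline z}=0$; its canonical decomposition is $f=h+\overline g$ with $h,g$ analytic in $\mathbb{D}$, $g(0)=0$. Its Jacobian is $J_f=|h'|^2-|g'|^2$. For $\nu>0$: $\mathcal{B}_H(\nu)$ is the set of harmonic mappings $f=h+\overline g$ in $\mathbb{D}$ with $\sup_{z\in\mathbb{D}}(1-|z|^2)^\nu(|h'(z)|+|g'(z)|)<\infty$; $\mathcal{B}(\nu)$ is the set of those $f\in\mathcal{B}_H(\nu)$ with $g\equiv0$ (analytic $f$); $\mathcal{B}^*_H(\nu)$ is the set of harmonic mappings $f$ in $\mathbb{D}$ with $\sup_{z\in\mathbb{D}}(1-|z|^2)^\nu\sqrt{|J_f(z)|}<\infty$. A family $L$ of harmonic mappings in $\mathbb{D}$ is affine invariant if $A\circ f\in L$ for each $f\in L$ and every affine mapping $A(z)=az+b\overline z$ with $a,b\in\mathbb{C}$. It is linear invariant if for each $f\in L$ one has $f\circ\varphi_\alpha\in L$ for all $\varphi_\alpha(z)=\frac{z+\alpha}{1+\overline\alpha z}$, $\alpha\in\mathbb{D}$. *)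

theory Defs
  imports "HOL-Complex_Analysis.Complex_Analysis"
begin

abbreviation unit_disc :: "complex set" where
  "unit_disc \<equiv> ball 0 1"

text \<open>The Wirtinger derivatives \<open>f\<^sub>z = (f\<^sub>x - i f\<^sub>y) / 2\<close> and its conjugate counterpart
  \<open>(f\<^sub>x + i f\<^sub>y) / 2\<close>; the real Frechet derivative applied to \<open>1\<close> and to \<open>\<i>\<close> yields the
  partial derivatives \<open>f\<^sub>x\<close> and \<open>f\<^sub>y\<close>. They are meaningful only at points where \<open>f\<close> is
  real differentiable.\<close>

definition wirtinger_z :: "(complex \<Rightarrow> complex) \<Rightarrow> complex \<Rightarrow> complex" where
  "wirtinger_z f z = (frechet_derivative f (at z) 1 - \<i> * frechet_derivative f (at z) \<i>) / 2"

definition wirtinger_zbar :: "(complex \<Rightarrow> complex) \<Rightarrow> complex \<Rightarrow> complex" where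
  "wirtinger_zbar f z = (frechet_derivative f (at z) 1 + \<i> * frechet_derivative f (at z) \<i>) / 2"

text \<open>Continuity of the derivative on the unit disc, expressed through the two Wirtinger derivatives,
  which determine the real derivative linearly.\<close>

definition C1_disc :: "(complex \<Rightarrow> complex) \<Rightarrow> bool" where
  "C1_disc f \<longleftrightarrow> (\<forall>z\<in>unit_disc. f differentiable (at z)) \<and>
     continuous_on unit_disc (wirtinger_z f) \<and> continuous_on unit_disc (wirtinger_zbar f)"

definition C2_disc :: "(complex \<Rightarrow> complex) \<Rightarrow> bool" where
  "C2_disc f \<longleftrightarrow> C1_disc f \<and> C1_disc (wirtinger_z f) \<and> C1_disc (wirtinger_zbar f)"

text \<open>Functions on the disc are represented by total functions on the complex plane; every notion
  below depends only on the values on \<open>unit_disc\<close>.\<close>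

definition harmonic_mapping :: "(complex \<Rightarrow> complex) \<Rightarrow> bool" where
  "harmonic_mapping f \<longleftrightarrow>
     C2_disc f \<and> (\<forall>z\<in>unit_disc. wirtinger_zbar (wirtinger_z f) z = 0)"

definition canonical_decomposition ::
    "(complex \<Rightarrow> complex) \<Rightarrow> (complex \<Rightarrow> complex) \<Rightarrow> (complex \<Rightarrow> complex) \<Rightarrow> bool" where
  "canonical_decomposition f h g \<longleftrightarrow>
     h holomorphic_on unit_disc \<and> g holomorphic_on unit_disc \<and> g 0 = 0 \<and>
     (\<forall>z\<in>unit_disc. f z = h z + cnj (g z))"

text \<open>The Jacobian of \<open>h + cnj \<circ> g\<close>.\<close>

definition jacobian :: "(complex \<Rightarrow> complex) \<Rightarrow> (complex \<Rightarrow> complex) \<Rightarrow> complex \<Rightarrow> real" where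
  "jacobian h g z = (cmod (deriv h z))\<^sup>2 - (cmod (deriv g z))\<^sup>2"

text \<open>The canonical decomposition of a harmonic mapping exists and is unique on \<open>unit_disc\<close>, so the
  existential quantifiers below merely name \<open>h\<close> and \<open>g\<close>.\<close>

definition harmonic_Bloch :: "real \<Rightarrow> (complex \<Rightarrow> complex) set" where
  "harmonic_Bloch \<nu> = {f. harmonic_mapping f \<and>
     (\<exists>h g. canonical_decomposition f h g \<and>
        bdd_above ((\<lambda>z. (1 - (cmod z)\<^sup>2) powr \<nu> * (cmod (deriv h z) + cmod (deriv g z))) ` unit_disc))}"

definition analytic_Bloch :: "real \<Rightarrow> (complex \<Rightarrow> complex) set" where
  "analytic_Bloch \<nu> = {f \<in> harmonic_Bloch \<nu>.
     \<exists>h g. canonical_decomposition f h g \<and> (\<forall>z\<in>unit_disc. g z = 0)}"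

definition harmonic_Bloch_star :: "real \<Rightarrow> (complex \<Rightarrow> complex) set" where
  "harmonic_Bloch_star \<nu> = {f. harmonic_mapping f \<and>
     (\<exists>h g. canonical_decomposition f h g \<and>
        bdd_above ((\<lambda>z. (1 - (cmod z)\<^sup>2) powr \<nu> * sqrt \<bar>jacobian h g z\<bar>) ` unit_disc))}"

definition affine_map :: "complex \<Rightarrow> complex \<Rightarrow> complex \<Rightarrow> complex" where
  "affine_map a b z = a * z + b * cnj z"

definition disc_automorphism :: "complex \<Rightarrow> complex \<Rightarrow> complex" where
  "disc_automorphism \<alpha> z = (z + \<alpha>) / (1 + cnj \<alpha> * z)"

definition affine_invariant :: "(complex \<Rightarrow> complex) set \<Rightarrow> bool" where
  "affine_invariant L \<longleftrightarrow> (\<forall>f\<in>L. \<forall>a b. affine_map a b \<circ> f \<in> L)"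

definition linear_invariant :: "(complex \<Rightarrow> complex) set \<Rightarrow> bool" where
  "linear_invariant L \<longleftrightarrow> (\<forall>f\<in>L. \<forall>\<alpha>\<in>unit_disc. f \<circ> disc_automorphism \<alpha> \<in> L)"

end

theory Submission
  imports Defs
begin

text \<open>Every condition here is read off a canonical decomposition. Affine maps and disc automorphisms
  carry a canonical decomposition to an explicit one, up to moving a constant from the
  antianalytic to the analytic part. An affine map multiplies \<open>\<bar>h'\<bar> + \<bar>g'\<bar>\<close> by at most
  \<open>\<bar>a\<bar> + \<bar>b\<bar>\<close> and the Jacobian by exactly \<open>\<bar>a\<bar>\<^sup>2 - \<bar>b\<bar>\<^sup>2\<close>. An automorphism \<open>\<phi>\<close> multiplies both
  \<open>\<bar>h'\<bar> + \<bar>g'\<bar>\<close> and \<open>\<surd>\<bar>J\<bar>\<close> by \<open>\<bar>\<phi>'\<bar>\<close>; since \<open>(1 - \<bar>z\<bar>\<^sup>2) \<bar>\<phi>'(z)\<bar> = 1 - \<bar>\<phi>(z)\<bar>\<^sup>2\<close>, the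
  weighted quantity at \<open>z\<close> is the one at \<open>\<phi>(z)\<close> times \<open>\<bar>\<phi>'(z)\<bar> powr (1 - \<nu>)\<close>, which is bounded
  because \<open>\<bar>\<phi>'\<bar>\<close> is bounded above and away from zero.\<close>

section \<open>Wirtinger derivatives and harmonicity of a decomposed function\<close>

text \<open>The real derivative at \<open>z\<close> is \<open>v\<close> \<mapsto>
  \<open>h'(z) v + cnj (g'(z) v)\<close>; evaluating it at \<open>1\<close> and \<open>\<i>\<close>
  separates the two parts. No normalisation of \<open>g\<close> at \<open>0\<close> is imposed, so
  the result applies again to \<open>wirtinger_z f\<close> and
  \<open>wirtinger_zbar f\<close>.\<close>

lemma
  assumes h: "h holomorphic_on unit_disc" and g: "g holomorphic_on unit_disc"
    and f: "\<And>z. z \<in> unit_disc \<Longrightarrow> f z = h z + cnj (g z)"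
  shows C1_disc_decomposition: "C1_disc f"
    and wirtinger_z_decomposition: "\<And>z. z \<in> unit_disc \<Longrightarrow> wirtinger_z f z = deriv h z"
    and wirtinger_zbar_decomposition: "\<And>z. z \<in> unit_disc \<Longrightarrow> wirtinger_zbar f z = cnj (deriv g z)"
proof -
  have D: "(f has_derivative (\<lambda>v. deriv h z * v + cnj (deriv g z * v))) (at z)"
    if z: "z \<in> unit_disc" for z
  proof -
    have "(h has_derivative (*) (deriv h z)) (at z)" "(g has_derivative (*) (deriv g z)) (at z)"
      using holomorphic_derivI[OF h _ z] holomorphic_derivI[OF g _ z]
      by (simp_all add: has_field_derivative_def)
    then have "((\<lambda>w. h w + cnj (g w)) has_derivative (\<lambda>v. deriv h z * v + cnj (deriv g z * v))) (at z)"
      by (intro has_derivative_add has_derivative_cnj)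
    then show ?thesis
      by (rule has_derivative_transform_within_open[OF _ open_ball z]) (simp add: f)
  qed
  have fd: "frechet_derivative f (at z) = (\<lambda>v. deriv h z * v + cnj (deriv g z * v))"
    if "z \<in> unit_disc" for z
    using frechet_derivative_at[OF D[OF that]] by simp
  show wz: "wirtinger_z f z = deriv h z" if "z \<in> unit_disc" for z
    by (simp add: wirtinger_z_def fd[OF that] algebra_simps)
  show wzb: "wirtinger_zbar f z = cnj (deriv g z)" if "z \<in> unit_disc" for z
    by (simp add: wirtinger_zbar_def fd[OF that] algebra_simps)
  have "continuous_on unit_disc (deriv h)" "continuous_on unit_disc (deriv g)"
    using h g by (auto intro!: holomorphic_on_imp_continuous_on holomorphic_deriv)
  then have "continuous_on unit_disc (wirtinger_z f)" "continuous_on unit_disc (wirtinger_zbar f)"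
    using wz wzb by (auto cong: continuous_on_cong_simp intro: continuous_on_cnj)
  then show "C1_disc f"
    unfolding C1_disc_def differentiable_def using D by blast
qed

lemma canonical_decomposition_imp_harmonic:
  assumes "canonical_decomposition f h g"
  shows "harmonic_mapping f"
proof -
  have h: "h holomorphic_on unit_disc" and g: "g holomorphic_on unit_disc"
    and f: "\<And>z. z \<in> unit_disc \<Longrightarrow> f z = h z + cnj (g z)"
    using assms by (auto simp: canonical_decomposition_def)
  have h': "deriv h holomorphic_on unit_disc" and g': "deriv g holomorphic_on unit_disc"
    using h g by (auto intro: holomorphic_deriv)
  \<comment> \<open>The zero summands put both Wirtinger derivatives into the form holomorphic plus
    conjugate of holomorphic, so that they are \<open>C1_disc\<close> in turn; the conjugate part
    \<open>0\<close> of \<open>wirtinger_z f\<close> yields harmonicity.\<close>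
  have z: "wirtinger_z f z = deriv h z + cnj 0" if "z \<in> unit_disc" for z
    using wirtinger_z_decomposition[OF h g f that] by simp
  have zb: "wirtinger_zbar f z = 0 + cnj (deriv g z)" if "z \<in> unit_disc" for z
    using wirtinger_zbar_decomposition[OF h g f that] by simp
  show ?thesis
    unfolding harmonic_mapping_def C2_disc_def
    using C1_disc_decomposition[OF h g f] C1_disc_decomposition[OF h' holomorphic_on_const z]
      C1_disc_decomposition[OF holomorphic_on_const g' zb]
      wirtinger_zbar_decomposition[OF h' holomorphic_on_const z]
    by auto
qed

lemma harmonic_Bloch_iff:
  "f \<in> harmonic_Bloch \<nu> \<longleftrightarrow> (\<exists>h g. canonical_decomposition f h g \<and>
     bdd_above ((\<lambda>z. (1 - (cmod z)\<^sup>2) powr \<nu> * (cmod (deriv h z) + cmod (deriv g z))) ` unit_disc))"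
  using canonical_decomposition_imp_harmonic by (auto simp: harmonic_Bloch_def)

lemma harmonic_Bloch_star_iff:
  "f \<in> harmonic_Bloch_star \<nu> \<longleftrightarrow> (\<exists>h g. canonical_decomposition f h g \<and>
     bdd_above ((\<lambda>z. (1 - (cmod z)\<^sup>2) powr \<nu> * sqrt \<bar>jacobian h g z\<bar>) ` unit_disc))"
  using canonical_decomposition_imp_harmonic by (auto simp: harmonic_Bloch_star_def)

section \<open>Pointwise comparison and affine invariance\<close>

lemma bdd_above_scaled:
  fixes u v :: "'a \<Rightarrow> real"
  assumes "bdd_above (u ` S)" "0 \<le> c" "\<And>z. z \<in> S \<Longrightarrow> v z \<le> c * u z"
  shows "bdd_above (v ` S)"
proof -
  obtain M where "\<And>z. z \<in> S \<Longrightarrow> u z \<le> M"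
    using assms(1) by (auto simp: bdd_above_def)
  then have "v z \<le> c * M" if "z \<in> S" for z
    using assms(2,3) that by (meson mult_left_mono order_trans)
  then show ?thesis
    by (auto simp: bdd_above_def)
qed

text \<open>Expanding \<open>a (h + cnj g) + b cnj (h + cnj g)\<close> gives the parts
  \<open>a h + b g\<close> and \<open>cnj a g + cnj b h\<close>. The latter equals
  \<open>cnj b * h 0\<close> at \<open>0\<close>; subtracting this value from it forces its
  conjugate \<open>b * cnj (h 0)\<close> into \<open>H\<close>.\<close>

lemma
  fixes a b :: complex
  assumes "canonical_decomposition f h g"
  defines "H \<equiv> \<lambda>z. a * h z + b * g z + b * cnj (h 0)"
    and "G \<equiv> \<lambda>z. cnj a * g z + cnj b * h z - cnj b * h 0"
  shows canonical_decomposition_affine: "canonical_decomposition (affine_map a b \<circ> f) H G"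
    and deriv_affine_analytic: "\<And>z. z \<in> unit_disc \<Longrightarrow> deriv H z = a * deriv h z + b * deriv g z"
    and deriv_affine_antianalytic:
      "\<And>z. z \<in> unit_disc \<Longrightarrow> deriv G z = cnj a * deriv g z + cnj b * deriv h z"
proof -
  have h: "h holomorphic_on unit_disc" and g: "g holomorphic_on unit_disc" and "g 0 = 0"
    and f: "\<And>z. z \<in> unit_disc \<Longrightarrow> f z = h z + cnj (g z)"
    using assms by (auto simp: canonical_decomposition_def)
  then show "canonical_decomposition (affine_map a b \<circ> f) H G"
    unfolding canonical_decomposition_def H_def G_def
    by (auto simp: affine_map_def algebra_simps intro!: holomorphic_intros)
  fix z :: complex assume z: "z \<in> unit_disc"
  note [derivative_intros] = holomorphic_derivI[OF h _ z] holomorphic_derivI[OF g _ z]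
  show "deriv H z = a * deriv h z + b * deriv g z"
    unfolding H_def by (rule DERIV_imp_deriv) (auto intro!: derivative_eq_intros)
  show "deriv G z = cnj a * deriv g z + cnj b * deriv h z"
    unfolding G_def by (rule DERIV_imp_deriv) (auto intro!: derivative_eq_intros)
qed

text \<open>This is multiplicativity of real determinants: with \<open>u\<close>, \<open>v\<close>
  as \<open>h'\<close>, \<open>g'\<close>, the factors on the right are the determinants of
  \<open>w\<close> \<mapsto> \<open>a w + b cnj w\<close> and \<open>w\<close> \<mapsto>
  \<open>u w + cnj (v w)\<close>, and the left side is that of their composite.\<close>

lemma norm_square_diff_affine:
  fixes a b u v :: complex
  shows "(cmod (a * u + b * v))\<^sup>2 - (cmod (cnj a * v + cnj b * u))\<^sup>2
    = ((cmod a)\<^sup>2 - (cmod b)\<^sup>2) * ((cmod u)\<^sup>2 - (cmod v)\<^sup>2)"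
  by (simp add: cmod_power2) algebra

lemma affine_invariant_harmonic_Bloch: "affine_invariant (harmonic_Bloch \<nu>)"
  unfolding affine_invariant_def
proof (intro ballI allI)
  fix f a b assume "f \<in> harmonic_Bloch \<nu>"
  then obtain h g where dec: "canonical_decomposition f h g" and bdd:
    "bdd_above ((\<lambda>z. (1 - (cmod z)\<^sup>2) powr \<nu> * (cmod (deriv h z) + cmod (deriv g z))) ` unit_disc)"
    by (auto simp: harmonic_Bloch_iff)
  have le: "cmod (a * u + b * v) + cmod (cnj a * v + cnj b * u)
      \<le> (cmod a + cmod b) * (cmod u + cmod v)" for u v
    using norm_triangle_ineq[of "a * u" "b * v"] norm_triangle_ineq[of "cnj a * v" "cnj b * u"]
    by (simp add: norm_mult algebra_simps)
  show "affine_map a b \<circ> f \<in> harmonic_Bloch \<nu>"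
    unfolding harmonic_Bloch_iff
  proof (intro exI conjI)
    show "canonical_decomposition (affine_map a b \<circ> f)
      (\<lambda>z. a * h z + b * g z + b * cnj (h 0)) (\<lambda>z. cnj a * g z + cnj b * h z - cnj b * h 0)"
      by (rule canonical_decomposition_affine[OF dec])
    show "bdd_above ((\<lambda>z. (1 - (cmod z)\<^sup>2) powr \<nu> *
        (cmod (deriv (\<lambda>z. a * h z + b * g z + b * cnj (h 0)) z) +
         cmod (deriv (\<lambda>z. cnj a * g z + cnj b * h z - cnj b * h 0) z))) ` unit_disc)"
    proof (rule bdd_above_scaled[OF bdd, where c = "cmod a + cmod b"])
      fix z assume z: "z \<in> unit_disc"
      show "(1 - (cmod z)\<^sup>2) powr \<nu> *
        (cmod (deriv (\<lambda>z. a * h z + b * g z + b * cnj (h 0)) z) +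
         cmod (deriv (\<lambda>z. cnj a * g z + cnj b * h z - cnj b * h 0) z))
        \<le> (cmod a + cmod b) * ((1 - (cmod z)\<^sup>2) powr \<nu> * (cmod (deriv h z) + cmod (deriv g z)))"
        using mult_left_mono[OF le[of "deriv h z" "deriv g z"] powr_ge_zero[of "1 - (cmod z)\<^sup>2" \<nu>]]
        by (simp add: deriv_affine_analytic[OF dec z] deriv_affine_antianalytic[OF dec z]
            mult.left_commute)
    qed simp
  qed
qed

lemma affine_invariant_harmonic_Bloch_star: "affine_invariant (harmonic_Bloch_star \<nu>)"
  unfolding affine_invariant_def
proof (intro ballI allI)
  fix f a b assume "f \<in> harmonic_Bloch_star \<nu>"
  then obtain h g where dec: "canonical_decomposition f h g" and bdd:
    "bdd_above ((\<lambda>z. (1 - (cmod z)\<^sup>2) powr \<nu> * sqrt \<bar>jacobian h g z\<bar>) ` unit_disc)"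
    by (auto simp: harmonic_Bloch_star_iff)
  show "affine_map a b \<circ> f \<in> harmonic_Bloch_star \<nu>"
    unfolding harmonic_Bloch_star_iff
  proof (intro exI conjI)
    show "canonical_decomposition (affine_map a b \<circ> f)
      (\<lambda>z. a * h z + b * g z + b * cnj (h 0)) (\<lambda>z. cnj a * g z + cnj b * h z - cnj b * h 0)"
      by (rule canonical_decomposition_affine[OF dec])
    show "bdd_above ((\<lambda>z. (1 - (cmod z)\<^sup>2) powr \<nu> *
        sqrt \<bar>jacobian (\<lambda>z. a * h z + b * g z + b * cnj (h 0))
          (\<lambda>z. cnj a * g z + cnj b * h z - cnj b * h 0) z\<bar>) ` unit_disc)"
    proof (rule bdd_above_scaled[OF bdd, where c = "sqrt \<bar>(cmod a)\<^sup>2 - (cmod b)\<^sup>2\<bar>"])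
      fix z assume z: "z \<in> unit_disc"
      show "(1 - (cmod z)\<^sup>2) powr \<nu> *
        sqrt \<bar>jacobian (\<lambda>z. a * h z + b * g z + b * cnj (h 0))
          (\<lambda>z. cnj a * g z + cnj b * h z - cnj b * h 0) z\<bar>
        \<le> sqrt \<bar>(cmod a)\<^sup>2 - (cmod b)\<^sup>2\<bar> * ((1 - (cmod z)\<^sup>2) powr \<nu> * sqrt \<bar>jacobian h g z\<bar>)"
        by (simp add: jacobian_def deriv_affine_analytic[OF dec z]
            deriv_affine_antianalytic[OF dec z] norm_square_diff_affine abs_mult real_sqrt_mult)
    qed simp
  qed
qed

text \<open>The power is increasing or decreasing in \<open>x\<close> according to the sign of
  \<open>s\<close>. The interval from \<open>1 / K\<close> to \<open>K\<close> is symmetric under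
  inversion, so its extreme endpoint gives the same bound in both cases.\<close>

lemma powr_le_powr_abs:
  fixes K x s :: real
  assumes "0 < K" "1 / K \<le> x" "x \<le> K"
  shows "x powr s \<le> K powr \<bar>s\<bar>"
proof (cases "0 \<le> s")
  case True
  have "0 \<le> x"
    using assms by (meson divide_nonneg_pos order_trans zero_le_one)
  then show ?thesis
    using True assms by (simp add: powr_mono2)
next
  case False
  then have "x powr s \<le> (1 / K) powr s"
    using assms by (intro powr_mono2') auto
  also have "\<dots> = K powr \<bar>s\<bar>"
    using False assms by (simp add: powr_divide powr_minus_divide)
  finally show ?thesis .
qed

section \<open>Disc automorphisms and the size of their derivatives\<close>

context
  fixes \<alpha> :: complex
  assumes \<alpha>: "\<alpha> \<in> unit_disc"
begin

text \<open>The library's map has rotation angle \<open>0\<close> here and sends its parameter to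
  \<open>0\<close>, hence the sign of \<open>\<alpha>\<close>. Holomorphy and invariance of the disc
  are inherited from it.\<close>

lemma disc_automorphism_eq_Moebius: "disc_automorphism \<alpha> = Moebius_function 0 (- \<alpha>)"
  by (auto simp: disc_automorphism_def Moebius_function_def)

lemma holomorphic_disc_automorphism: "disc_automorphism \<alpha> holomorphic_on unit_disc"
  using \<alpha> by (simp add: disc_automorphism_eq_Moebius Moebius_function_holomorphic)

lemma disc_automorphism_in_disc: "disc_automorphism \<alpha> z \<in> unit_disc" if "z \<in> unit_disc"
  using \<alpha> that by (simp add: disc_automorphism_eq_Moebius Moebius_function_norm_lt_1)

lemma norm_disc_automorphism_denom:
  assumes "z \<in> unit_disc"
  shows "1 - cmod \<alpha> \<le> cmod (1 + cnj \<alpha> * z)" "cmod (1 + cnj \<alpha> * z) \<le> 1 + cmod \<alpha>"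
proof -
  have "cmod (cnj \<alpha> * z) \<le> cmod \<alpha>"
    using assms by (simp add: norm_mult mult_left_le)
  then show "1 - cmod \<alpha> \<le> cmod (1 + cnj \<alpha> * z)" "cmod (1 + cnj \<alpha> * z) \<le> 1 + cmod \<alpha>"
    using norm_diff_ineq[of 1 "cnj \<alpha> * z"] norm_triangle_ineq[of 1 "cnj \<alpha> * z"] by auto
qed

lemma disc_automorphism_denom_nonzero: "1 + cnj \<alpha> * z \<noteq> 0" if "z \<in> unit_disc"
  using norm_disc_automorphism_denom(1)[OF that] \<alpha> by auto

lemma norm_deriv_disc_automorphism:
  assumes "z \<in> unit_disc"
  shows "cmod (deriv (disc_automorphism \<alpha>) z) = (1 - (cmod \<alpha>)\<^sup>2) / (cmod (1 + cnj \<alpha> * z))\<^sup>2"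
proof -
  have "((\<lambda>z. (z + \<alpha>) / (1 + cnj \<alpha> * z)) has_field_derivative
      (1 - \<alpha> * cnj \<alpha>) / (1 + cnj \<alpha> * z)\<^sup>2) (at z)"
    using disc_automorphism_denom_nonzero[OF assms]
    by (auto intro!: derivative_eq_intros simp: power2_eq_square algebra_simps)
  then have "deriv (disc_automorphism \<alpha>) z = (1 - \<alpha> * cnj \<alpha>) / (1 + cnj \<alpha> * z)\<^sup>2"
    by (intro DERIV_imp_deriv) (simp add: disc_automorphism_def[abs_def])
  moreover have "1 - \<alpha> * cnj \<alpha> = of_real (1 - (cmod \<alpha>)\<^sup>2)"
    by (simp add: complex_norm_square[symmetric])
  \<comment> \<open>This makes the numerator nonnegative, so it is its own absolute value.\<close>
  moreover have "(cmod \<alpha>)\<^sup>2 \<le> 1"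
    using \<alpha> by (simp add: power_le_one)
  ultimately show ?thesis
    by (simp only: norm_divide norm_power norm_of_real)
qed

text \<open>Equality case of Schwarz-Pick: divide the polynomial identity below by the squared
  modulus of the denominator.\<close>

lemma schwarz_pick_disc_automorphism:
  assumes "z \<in> unit_disc"
  shows "1 - (cmod (disc_automorphism \<alpha> z))\<^sup>2
    = (1 - (cmod z)\<^sup>2) * cmod (deriv (disc_automorphism \<alpha>) z)"
proof -
  have "(cmod (1 + cnj \<alpha> * z))\<^sup>2 - (cmod (z + \<alpha>))\<^sup>2 = (1 - (cmod z)\<^sup>2) * (1 - (cmod \<alpha>)\<^sup>2)"
    by (simp add: cmod_power2) algebra
  then show ?thesis
    using disc_automorphism_denom_nonzero[OF assms]
    by (simp add: norm_deriv_disc_automorphism[OF assms] disc_automorphism_def norm_divide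
        power_divide field_simps)
qed

text \<open>Insert the extreme denominators \<open>1 - |\<alpha>|\<close> and
  \<open>1 + |\<alpha>|\<close> into the formula for the derivative; a factor of
  \<open>1 - |\<alpha>|^2\<close> cancels, leaving the reciprocal bounds \<open>K\<close> and
  \<open>1 / K\<close>.\<close>

lemma deriv_disc_automorphism_bounds:
  assumes "z \<in> unit_disc"
  defines "d \<equiv> cmod (deriv (disc_automorphism \<alpha>) z)"
    and "K \<equiv> (1 + cmod \<alpha>) / (1 - cmod \<alpha>)"
  shows "1 / K \<le> d" "d \<le> K" "0 < d"
proof -
  have a: "cmod \<alpha> < 1"
    using \<alpha> by simp
  then have "d \<le> (1 - (cmod \<alpha>)\<^sup>2) / (1 - cmod \<alpha>)\<^sup>2" "(1 - (cmod \<alpha>)\<^sup>2) / (1 + cmod \<alpha>)\<^sup>2 \<le> d"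
    using norm_disc_automorphism_denom[OF assms(1)] disc_automorphism_denom_nonzero[OF assms(1)]
    unfolding d_def norm_deriv_disc_automorphism[OF assms(1)]
    by (auto intro!: divide_left_mono power_mono mult_pos_pos zero_less_power simp: power_le_one)
  moreover have "(1 - (cmod \<alpha>)\<^sup>2) / (1 - cmod \<alpha>)\<^sup>2 = K" "(1 - (cmod \<alpha>)\<^sup>2) / (1 + cmod \<alpha>)\<^sup>2 = 1 / K"
  proof -
    have "1 - (cmod \<alpha>)\<^sup>2 = (1 + cmod \<alpha>) * (1 - cmod \<alpha>)"
      by (simp add: power2_eq_square algebra_simps)
    moreover have "1 - cmod \<alpha> \<noteq> 0" "1 + cmod \<alpha> \<noteq> 0"
      using a norm_ge_zero[of \<alpha>] by linarith+
    ultimately show "(1 - (cmod \<alpha>)\<^sup>2) / (1 - cmod \<alpha>)\<^sup>2 = K" "(1 - (cmod \<alpha>)\<^sup>2) / (1 + cmod \<alpha>)\<^sup>2 = 1 / K"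
      by (auto simp: K_def power2_eq_square)
  qed
  moreover have "0 < 1 / K"
    using a unfolding K_def by (simp add: add_pos_nonneg)
  ultimately show "1 / K \<le> d" "d \<le> K" "0 < d"
    by linarith+
qed

section \<open>Linear invariance\<close>

text \<open>\<open>W\<close> stands for \<open>|h'| + |g'|\<close> or for \<open>sqrt |J|\<close>,
  and \<open>V\<close> for the same quantity of the composite, so one estimate serves all three
  classes.\<close>

lemma bdd_above_weighted_disc_automorphism:
  fixes W :: "complex \<Rightarrow> real"
  assumes bdd: "bdd_above ((\<lambda>z. (1 - (cmod z)\<^sup>2) powr \<nu> * W z) ` unit_disc)"
    and W: "\<And>z. 0 \<le> W z"
    and V: "\<And>z. z \<in> unit_disc \<Longrightarrow>
      V z = W (disc_automorphism \<alpha> z) * cmod (deriv (disc_automorphism \<alpha>) z)"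
  shows "bdd_above ((\<lambda>z. (1 - (cmod z)\<^sup>2) powr \<nu> * V z) ` unit_disc)"
proof -
  let ?\<phi> = "disc_automorphism \<alpha>"
  define K where "K = (1 + cmod \<alpha>) / (1 - cmod \<alpha>)"
  have K: "0 < K"
    using \<alpha> unfolding K_def by (simp add: add_pos_nonneg)
  have "bdd_above ((\<lambda>z. (1 - (cmod z)\<^sup>2) powr \<nu> * W z) ` ?\<phi> ` unit_disc)"
    by (rule bdd_above_mono[OF bdd]) (intro image_mono, use disc_automorphism_in_disc in blast)
  then have "bdd_above ((\<lambda>z. (1 - (cmod (?\<phi> z))\<^sup>2) powr \<nu> * W (?\<phi> z)) ` unit_disc)"
    by (simp add: image_image)
  then show ?thesis
  proof (rule bdd_above_scaled[where c = "K powr \<bar>1 - \<nu>\<bar>"])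
    fix z assume z: "z \<in> unit_disc"
    define d where "d = cmod (deriv ?\<phi> z)"
    have d: "1 / K \<le> d" "d \<le> K" "0 < d"
      using deriv_disc_automorphism_bounds[OF z] by (auto simp: d_def K_def)
    have "0 \<le> 1 - (cmod z)\<^sup>2"
      using z by (simp add: power_le_one)
    \<comment> \<open>The factor \<open>d\<close> of \<open>V z\<close> splits as
      \<open>d powr \<nu> * d powr (1 - \<nu>)\<close>; its first part turns the weight at
      \<open>z\<close> into the weight at the image point.\<close>
    then have "(1 - (cmod z)\<^sup>2) powr \<nu> * V z
        = d powr (1 - \<nu>) * ((1 - (cmod (?\<phi> z))\<^sup>2) powr \<nu> * W (?\<phi> z))"
      using d(3) by (simp add: V[OF z] schwarz_pick_disc_automorphism[OF z] powr_mult powr_diff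
          flip: d_def)
    also have "\<dots> \<le> K powr \<bar>1 - \<nu>\<bar> * ((1 - (cmod (?\<phi> z))\<^sup>2) powr \<nu> * W (?\<phi> z))"
      using powr_le_powr_abs[OF K d(1,2)] W by (intro mult_right_mono) auto
    finally show "(1 - (cmod z)\<^sup>2) powr \<nu> * V z
      \<le> K powr \<bar>1 - \<nu>\<bar> * ((1 - (cmod (?\<phi> z))\<^sup>2) powr \<nu> * W (?\<phi> z))" .
  qed simp
qed

lemma deriv_comp_disc_automorphism:
  assumes h: "h holomorphic_on unit_disc" and z: "z \<in> unit_disc"
  shows "deriv (\<lambda>z. h (disc_automorphism \<alpha> z) + c) z
    = deriv h (disc_automorphism \<alpha> z) * deriv (disc_automorphism \<alpha>) z"
proof -
  have "((h \<circ> disc_automorphism \<alpha>) has_field_derivative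
      deriv h (disc_automorphism \<alpha> z) * deriv (disc_automorphism \<alpha>) z) (at z)"
    using holomorphic_derivI[OF h _ disc_automorphism_in_disc[OF z]]
      holomorphic_derivI[OF holomorphic_disc_automorphism _ z]
    by (intro DERIV_chain) auto
  then show ?thesis
    by (intro DERIV_imp_deriv) (auto intro!: derivative_eq_intros simp: o_def)
qed

text \<open>The composite \<open>g \<circ> disc_automorphism \<alpha>\<close> takes the value
  \<open>g \<alpha>\<close> at \<open>0\<close>, which may be nonzero; its conjugate is moved to the
  analytic part.\<close>

lemma canonical_decomposition_disc_automorphism:
  assumes "canonical_decomposition f h g"
  shows "canonical_decomposition (f \<circ> disc_automorphism \<alpha>)
    (\<lambda>z. h (disc_automorphism \<alpha> z) + cnj (g (disc_automorphism \<alpha> 0)))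
    (\<lambda>z. g (disc_automorphism \<alpha> z) + - g (disc_automorphism \<alpha> 0))"
proof -
  have "(\<lambda>z. u (disc_automorphism \<alpha> z)) holomorphic_on unit_disc"
    if "u holomorphic_on unit_disc" for u
    using holomorphic_on_compose_gen[OF holomorphic_disc_automorphism that
        image_subsetI[OF disc_automorphism_in_disc]] by (simp add: o_def)
  then show ?thesis
    using assms disc_automorphism_in_disc unfolding canonical_decomposition_def
    by (auto intro!: holomorphic_intros)
qed

lemma harmonic_Bloch_disc_automorphism:
  assumes "f \<in> harmonic_Bloch \<nu>"
  shows "f \<circ> disc_automorphism \<alpha> \<in> harmonic_Bloch \<nu>"
proof -
  obtain h g where dec: "canonical_decomposition f h g" and bdd:
    "bdd_above ((\<lambda>z. (1 - (cmod z)\<^sup>2) powr \<nu> * (cmod (deriv h z) + cmod (deriv g z))) ` unit_disc)"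
    using assms by (auto simp: harmonic_Bloch_iff)
  then have "h holomorphic_on unit_disc" "g holomorphic_on unit_disc"
    by (auto simp: canonical_decomposition_def)
  note deriv = this[THEN deriv_comp_disc_automorphism]
  show ?thesis
    unfolding harmonic_Bloch_iff
    by (intro exI conjI, rule canonical_decomposition_disc_automorphism[OF dec],
        rule bdd_above_weighted_disc_automorphism[OF bdd])
      \<comment> \<open>Rewriting \<open>+ -\<close> to a subtraction would keep the equations
        \<open>deriv\<close>, stated for \<open>+ c\<close>, from matching the antianalytic
        part.\<close>
      (simp_all add: deriv norm_mult distrib_right del: add_uminus_conv_diff)
qed

text \<open>The recentred antianalytic part still vanishes, since the automorphism keeps every
  argument of \<open>g\<close> inside the disc, including the image of \<open>0\<close>.\<close>

lemma analytic_Bloch_disc_automorphism: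
  assumes "f \<in> analytic_Bloch \<nu>"
  shows "f \<circ> disc_automorphism \<alpha> \<in> analytic_Bloch \<nu>"
proof -
  obtain h g where dec: "canonical_decomposition f h g" and g: "\<And>z. z \<in> unit_disc \<Longrightarrow> g z = 0"
    using assms by (auto simp: analytic_Bloch_def)
  have "g (disc_automorphism \<alpha> z) + - g (disc_automorphism \<alpha> 0) = 0" if "z \<in> unit_disc" for z
    using g[OF disc_automorphism_in_disc[OF that]] g[OF disc_automorphism_in_disc[of 0]] by simp
  then show ?thesis
    using assms harmonic_Bloch_disc_automorphism canonical_decomposition_disc_automorphism[OF dec]
    unfolding analytic_Bloch_def by blast
qed

lemma harmonic_Bloch_star_disc_automorphism:
  assumes "f \<in> harmonic_Bloch_star \<nu>"
  shows "f \<circ> disc_automorphism \<alpha> \<in> harmonic_Bloch_star \<nu>"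
proof -
  obtain h g where dec: "canonical_decomposition f h g" and bdd:
    "bdd_above ((\<lambda>z. (1 - (cmod z)\<^sup>2) powr \<nu> * sqrt \<bar>jacobian h g z\<bar>) ` unit_disc)"
    using assms by (auto simp: harmonic_Bloch_star_iff)
  then have "h holomorphic_on unit_disc" "g holomorphic_on unit_disc"
    by (auto simp: canonical_decomposition_def)
  note deriv = this[THEN deriv_comp_disc_automorphism]
  \<comment> \<open>The Jacobian acquires the squared modulus of the automorphism's derivative, so
    its root acquires the modulus itself, as the weighted estimate requires.\<close>
  have sqrt: "sqrt \<bar>(x * d)\<^sup>2 - (y * d)\<^sup>2\<bar> = sqrt \<bar>x\<^sup>2 - y\<^sup>2\<bar> * d" if "0 \<le> d" for x y d :: real
  proof -
    have "(x * d)\<^sup>2 - (y * d)\<^sup>2 = (x\<^sup>2 - y\<^sup>2) * d\<^sup>2"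
      by (simp add: power_mult_distrib algebra_simps)
    then show ?thesis
      using that by (simp add: abs_mult real_sqrt_mult)
  qed
  show ?thesis
    unfolding harmonic_Bloch_star_iff
    by (intro exI conjI, rule canonical_decomposition_disc_automorphism[OF dec],
        rule bdd_above_weighted_disc_automorphism[OF bdd])
      (simp_all add: deriv norm_mult jacobian_def sqrt del: add_uminus_conv_diff)
qed

end

theorem proposition1:
  fixes \<nu> :: real
  assumes "\<nu> > 0"
  shows "affine_invariant (harmonic_Bloch \<nu>) \<and> affine_invariant (harmonic_Bloch_star \<nu>) \<and>
    linear_invariant (analytic_Bloch \<nu>) \<and> linear_invariant (harmonic_Bloch \<nu>) \<and>
    linear_invariant (harmonic_Bloch_star \<nu>)"
  using affine_invariant_harmonic_Bloch affine_invariant_harmonic_Bloch_star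
    analytic_Bloch_disc_automorphism harmonic_Bloch_disc_automorphism
    harmonic_Bloch_star_disc_automorphism
  by (simp add: linear_invariant_def)

end
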